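(* The convex domination number of $\pi G$ cannot be bounded, either from above or from below, in terms of $\gamma_{con}(G)$. Precisely: (a) there is no function $f:\mathbb{N}\to\mathbb{N}$ such that $\gamma_{con}(\pi G)\le f(\gamma_{con}(G))$ for every connected graph $G$ and every permutation $\pi$ of $V_G$; and (b) there is no function $f:\mathbb{N}\to\mathbb{N}$ such that $\gamma_{con}(G)\le f(\gamma_{con}(\pi G))$ for every connected graph $G$ and every permutation $\pi$ of $V_G$.
   Context: Graphs are finite, simple, undirected and nonempty. For a graph $G$ with vertex set $V_G$ and a permutation $\pi$ of $V_G$, let $G'$ be a vertex-disjoint copy of $G$, with $v'$ the copy of $v$. The prism graph $\pi G$ has vertex set $V_G\cup V_{G'}$ and edge set $E_G\cup E_{G'}\cup\{u\,\pi(u)':u\in V_G\}$. A set $A$ of vertices is dominating if every vertex of the graph is in $A$ or adjacent to a vertex of $A$. In a connected graph, $A$ is convex if for every $u,v\in A$ it contains all vertices of every shortest $u$--$v$ path of the graph. $\gamma_{con}$ denotes the minimum cardinality of a convex dominating set. *)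

theory Defs
  imports "Graph_Theory.Digraph_Component_Vwalk"
begin

text \<open>
  A finite simple undirected graph is a symmetric loop-free digraph without parallel arcs:
  an edge is the pair of its two arcs. This is the locale predicate \<^term>\<open>pair_graph\<close>.
  It admits the empty graph, while \<^const>\<open>Digraph_Component.connected\<close> excludes it.
\<close>

definition shortest_vpath :: "'a pair_pre_digraph \<Rightarrow> 'a \<Rightarrow> 'a vwalk \<Rightarrow> 'a \<Rightarrow> bool" where
  "shortest_vpath G u p v \<longleftrightarrow>
     vpath p (with_proj G) \<and> hd p = u \<and> last p = v \<and>
     (\<forall>q. vpath q (with_proj G) \<and> hd q = u \<and> last q = v \<longrightarrow> vwalk_length p \<le> vwalk_length q)"

definition convex_in :: "'a pair_pre_digraph \<Rightarrow> 'a set \<Rightarrow> bool" where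
  "convex_in G A \<longleftrightarrow>
     A \<subseteq> pverts G \<and> (\<forall>u\<in>A. \<forall>v\<in>A. \<forall>p. shortest_vpath G u p v \<longrightarrow> set p \<subseteq> A)"

definition dominating_in :: "'a pair_pre_digraph \<Rightarrow> 'a set \<Rightarrow> bool" where
  "dominating_in G A \<longleftrightarrow>
     A \<subseteq> pverts G \<and> (\<forall>v\<in>pverts G. v \<in> A \<or> (\<exists>u\<in>A. (u, v) \<in> parcs G))"

text \<open>
  For finite vertex sets the minimum below is taken over a finite nonempty set,
  see \<open>convex_domination_number_attained\<close>.
\<close>

definition convex_domination_number :: "'a pair_pre_digraph \<Rightarrow> nat" where
  "convex_domination_number G = Min (card ` {A. convex_in G A \<and> dominating_in G A})"

text \<open>
  The vertex \<open>v\<close> of the graph is \<open>Inl v\<close> in the prism, and its copy \<open>v'\<close> is \<open>Inr v\<close>.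
\<close>

definition prism :: "('a \<Rightarrow> 'a) \<Rightarrow> 'a pair_pre_digraph \<Rightarrow> ('a + 'a) pair_pre_digraph" where
  "prism \<pi> G = \<lparr>
     pverts = Inl ` pverts G \<union> Inr ` pverts G,
     parcs = {(Inl u, Inl v) |u v. (u, v) \<in> parcs G}
           \<union> {(Inr u, Inr v) |u v. (u, v) \<in> parcs G}
           \<union> {(Inl u, Inr (\<pi> u)) |u. u \<in> pverts G}
           \<union> {(Inr (\<pi> u), Inl u) |u. u \<in> pverts G}\<rparr>"

lemma finite_convex_dominating:
  assumes "finite (pverts G)"
  shows "finite {A. convex_in G A \<and> dominating_in G A}"
  by (rule finite_subset[of _ "Pow (pverts G)"]) (use assms in \<open>auto simp: convex_in_def\<close>)

lemma convex_dominating_pverts: "convex_in G (pverts G)" "dominating_in G (pverts G)"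
  by (auto simp: convex_in_def dominating_in_def shortest_vpath_def vpath_def vwalk_def)

lemma convex_domination_number_attained:
  assumes "finite (pverts G)"
  obtains A where "convex_in G A" "dominating_in G A" "card A = convex_domination_number G"
proof -
  let ?S = "{A. convex_in G A \<and> dominating_in G A}"
  have "finite (card ` ?S)" "card ` ?S \<noteq> {}"
    using finite_convex_dominating[OF assms] convex_dominating_pverts[of G] by auto
  from Min_in[OF this] that show thesis
    by (auto simp: convex_domination_number_def)
qed

lemma convex_domination_number_le:
  assumes "finite (pverts G)" "convex_in G A" "dominating_in G A"
  shows "convex_domination_number G \<le> card A"
  using finite_convex_dominating[OF assms(1)] assms(2,3)
  by (auto simp: convex_domination_number_def intro!: Min_le)

lemma pair_graph_prism:
  assumes "pair_graph G" "\<pi> permutes pverts G"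
  shows "pair_graph (prism \<pi> G)"
proof -
  interpret pair_graph G by fact
  have sym: "(v, u) \<in> parcs G" if "(u, v) \<in> parcs G" for u v
    using that by (rule arcs_symmetric)
  have verts: "\<pi> u \<in> pverts G" if "u \<in> pverts G" for u
    using that permutes_in_image[OF assms(2)] by simp
  have sub: "parcs (prism \<pi> G) \<subseteq> pverts (prism \<pi> G) \<times> pverts (prism \<pi> G)"
    using verts by (auto simp: prism_def dest: in_arcsD1 in_arcsD2)
  have fin: "finite (pverts (prism \<pi> G))"
    by (simp add: prism_def)
  show ?thesis
  proof
    show "finite (parcs (prism \<pi> G))"
      using finite_subset[OF sub] fin by blast
    show "symmetric (with_proj (prism \<pi> G))"
      unfolding symmetric_def by (rule symI) (auto simp: prism_def intro: sym)
    show "fst e \<noteq> snd e" if "e \<in> parcs (prism \<pi> G)" for e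
      using that by (auto simp: prism_def dest: no_loops')
  qed (use sub fin in auto)
qed

lemma connected_prism:
  assumes "pair_graph G" "Digraph_Component.connected (with_proj G)" "\<pi> permutes pverts G"
  shows "Digraph_Component.connected (with_proj (prism \<pi> G))"
proof -
  let ?P = "with_proj (prism \<pi> G)"
  interpret pair_graph G by fact
  interpret P: pair_graph "prism \<pi> G" using assms by (intro pair_graph_prism)
  have sc: "u \<rightarrow>\<^sup>*\<^bsub>with_proj G\<^esub> v" if "u \<in> pverts G" "v \<in> pverts G" for u v
    using symmetric_connected_imp_strongly_connected[OF sym_arcs assms(2)] that
    by (auto simp: strongly_connected_def)
  have pv: "pverts (prism \<pi> G) = Inl ` pverts G \<union> Inr ` pverts G"
    by (simp add: prism_def)
  have arcs: "(Inl u, Inl v) \<in> parcs (prism \<pi> G)" "(Inr u, Inr v) \<in> parcs (prism \<pi> G)"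
    if "(u, v) \<in> parcs G" for u v
    using that by (auto simp: prism_def)
  have lift: "Inl u \<rightarrow>\<^sup>*\<^bsub>?P\<^esub> Inl v \<and> Inr u \<rightarrow>\<^sup>*\<^bsub>?P\<^esub> Inr v"
    if "u \<rightarrow>\<^sup>*\<^bsub>with_proj G\<^esub> v" for u v
    using that
  proof (induction rule: reachable_induct)
    case base
    then show ?case by (simp add: pv)
  next
    case (step y z)
    then have "(y, z) \<in> parcs G" by simp
    from arcs[OF this] step.IH show ?case
      by (blast intro: P.reachable_adj_trans)
  qed
  have cross: "Inl u \<rightarrow>\<^sup>*\<^bsub>?P\<^esub> Inr (\<pi> u)" "Inr (\<pi> u) \<rightarrow>\<^sup>*\<^bsub>?P\<^esub> Inl u" if "u \<in> pverts G" for u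
  proof -
    have "(Inl u, Inr (\<pi> u)) \<in> parcs (prism \<pi> G)" "(Inr (\<pi> u), Inl u) \<in> parcs (prism \<pi> G)"
      using that by (auto simp: prism_def)
    then show "Inl u \<rightarrow>\<^sup>*\<^bsub>?P\<^esub> Inr (\<pi> u)" "Inr (\<pi> u) \<rightarrow>\<^sup>*\<^bsub>?P\<^esub> Inl u"
      by (simp_all add: P.reachable_adjI)
  qed
  have img: "\<pi> u \<in> pverts G" if "u \<in> pverts G" for u
    using that permutes_in_image[OF assms(3)] by simp
  have "x \<rightarrow>\<^sup>*\<^bsub>?P\<^esub> y" if xy: "x \<in> pverts (prism \<pi> G)" "y \<in> pverts (prism \<pi> G)" for x y
  proof -
    obtain u where u: "u \<in> pverts G" "x \<rightarrow>\<^sup>*\<^bsub>?P\<^esub> Inl u"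
    proof (cases x)
      case (Inl a)
      with xy(1) have "a \<in> pverts G" by (auto simp: pv)
      with Inl xy(1) show ?thesis using that by (blast intro: P.reachable_refl)
    next
      case (Inr a)
      with xy(1) have a: "a \<in> pverts G" by (auto simp: pv)
      then have "Inr a \<rightarrow>\<^sup>*\<^bsub>?P\<^esub> Inr (\<pi> a)" using lift[OF sc] img by blast
      with cross(2)[OF a] have "Inr a \<rightarrow>\<^sup>*\<^bsub>?P\<^esub> Inl a" by (rule P.reachable_trans[rotated])
      with Inr a show ?thesis using that by blast
    qed
    obtain v where v: "v \<in> pverts G" "Inl v \<rightarrow>\<^sup>*\<^bsub>?P\<^esub> y"
    proof (cases y)
      case (Inl a)
      with xy(2) have "a \<in> pverts G" by (auto simp: pv)
      with Inl xy(2) show ?thesis using that by (blast intro: P.reachable_refl)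
    next
      case (Inr a)
      with xy(2) have a: "a \<in> pverts G" by (auto simp: pv)
      then have "Inr (\<pi> a) \<rightarrow>\<^sup>*\<^bsub>?P\<^esub> Inr a" using lift[OF sc] img by blast
      with cross(1)[OF a] have "Inl a \<rightarrow>\<^sup>*\<^bsub>?P\<^esub> Inr a" by (rule P.reachable_trans)
      with Inr a show ?thesis using that by blast
    qed
    have "Inl u \<rightarrow>\<^sup>*\<^bsub>?P\<^esub> Inl v" using lift[OF sc[OF u(1) v(1)]] by simp
    then show ?thesis using u(2) v(2) by (blast intro: P.reachable_trans)
  qed
  moreover have "pverts (prism \<pi> G) \<noteq> {}"
    using assms(2) by (auto simp: pv connected_conv)
  moreover have "(arcs_ends ?P)\<^sup>s = arcs_ends ?P"
    using P.arcs_symmetric by (auto simp: symcl_def)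
  ultimately show ?thesis
    by (simp add: connected_conv reachable_def)
qed

end

theory Submission
  imports Defs
begin

text \<open>
  Two non-adjacent vertices joined by \<open>n\<close> internally disjoint shortest paths force all these paths into
  every convex set containing both. If a dominating set must contain both or else about \<open>n\<close> other
  vertices, the convex domination number is at least \<open>n\<close>. A double star has no such pair, but a
  permutation matching the leaves of one centre with those of the other creates one in the prism.
  Conversely, a graph with such a pair can have a prism in which a few leaves of the first vertex, and
  of its copy, dominate the far end of the paths across the matching, so that no path is forced.
\<close>

section \<open>Counting, and paths with at most four vertices\<close>

text \<open>Sending \<open>i\<close> to whichever of \<open>f i\<close> and \<open>g i\<close> lies
  in \<open>A\<close> is injective because the two families are disjoint.\<close>

lemma card_ge_of_disjoint_pairs:
  fixes f g :: "nat \<Rightarrow> 'a"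
  assumes "finite A" and meets: "\<And>i. i < n \<Longrightarrow> f i \<in> A \<or> g i \<in> A"
    and inj: "inj f" "inj g" and disj: "\<And>i j. f i \<noteq> g j"
  shows "n \<le> card A"
proof -
  define h where "h i = (if f i \<in> A then f i else g i)" for i
  have "inj_on h {..<n}"
    using inj disj disj[symmetric] by (auto simp: inj_on_def h_def dest: injD)
  moreover have "h ` {..<n} \<subseteq> A"
    using meets by (auto simp: h_def)
  ultimately show ?thesis
    using card_inj_on_le[of h "{..<n}" A] \<open>finite A\<close> by simp
qed

lemma involution_permutes:
  assumes "\<And>x. f (f x) = x" "\<And>x. x \<notin> S \<Longrightarrow> f x = x"
  shows "f permutes S"
  unfolding permutes_def using assms by metis

lemma vwalk_with_proj_Cons_Cons [simp]:
  assumes "pair_graph G"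
  shows "vwalk (x # y # p) (with_proj G) \<longleftrightarrow> (x, y) \<in> parcs G \<and> vwalk (y # p) (with_proj G)"
proof -
  interpret pair_graph G by fact
  show ?thesis
    by (auto simp: vwalk_def dest: in_arcsD1)
qed

lemma vwalk_with_proj_singleton [simp]: "vwalk [x] (with_proj G) \<longleftrightarrow> x \<in> pverts G"
  by (simp add: vwalk_def)

text \<open>Every shortest path considered has at most four vertices, so it and its competitors can
  be treated by enumerating their vertices.\<close>

lemma list_le_4_cases:
  assumes "p \<noteq> []" "length p \<le> 4"
  obtains a where "p = [a]" | a b where "p = [a, b]" | a b c where "p = [a, b, c]"
    | a b c d where "p = [a, b, c, d]"
proof -
  have "length p > 0" using assms(1) by simp
  then have "length p = 1 \<or> length p = 2 \<or> length p = 3 \<or> length p = 4"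
    using assms(2) by linarith
  then show thesis using that by (auto simp: length_Suc_conv numeral_eq_Suc)
qed

text \<open>
  Since any two vertices of \<open>A\<close> have distance at most \<open>3\<close>, a shortest path can only leave \<open>A\<close> through
  one vertex or through two consecutive vertices.
\<close>

lemma convex_inI:
  assumes G: "pair_graph G" and sub: "A \<subseteq> pverts G"
    and diam: "\<And>u v. u \<in> A \<Longrightarrow> v \<in> A \<Longrightarrow>
      \<exists>q. vpath q (with_proj G) \<and> hd q = u \<and> last q = v \<and> vwalk_length q \<le> 3"
    and one: "\<And>u x v. u \<in> A \<Longrightarrow> x \<notin> A \<Longrightarrow> v \<in> A \<Longrightarrow>
      (u, x) \<in> parcs G \<Longrightarrow> (x, v) \<in> parcs G \<Longrightarrow> u = v"
    and two: "\<And>u x y v. u \<in> A \<Longrightarrow> x \<notin> A \<Longrightarrow> y \<notin> A \<Longrightarrow> v \<in> A \<Longrightarrow>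
      (u, x) \<in> parcs G \<Longrightarrow> (x, y) \<in> parcs G \<Longrightarrow> (y, v) \<in> parcs G \<Longrightarrow>
      u = v \<or> (u, v) \<in> parcs G \<or> (\<exists>w. (u, w) \<in> parcs G \<and> (w, v) \<in> parcs G)"
  shows "convex_in G A"
  unfolding convex_in_def
proof (intro conjI ballI allI impI sub)
  fix u v p
  assume uv: "u \<in> A" "v \<in> A" and "shortest_vpath G u p v"
  then have p: "vpath p (with_proj G)" "hd p = u" "last p = v"
    and le: "\<And>q. vpath q (with_proj G) \<Longrightarrow> hd q = u \<Longrightarrow> last q = v \<Longrightarrow> vwalk_length p \<le> vwalk_length q"
    by (auto simp: shortest_vpath_def)
  interpret pair_graph G by fact
  have ne: "p \<noteq> []" using p(1) by (auto simp: vpath_def)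
  obtain q where "vpath q (with_proj G)" "hd q = u" "last q = v" "vwalk_length q \<le> 3"
    using diam[OF uv] by blast
  with le[of q] have "vwalk_length p \<le> 3" by simp
  then have "length p \<le> 4" by (cases p) auto
  from ne this show "set p \<subseteq> A"
  proof (cases rule: list_le_4_cases)
    case (4 a x y b)
    then have ab: "a = u" "b = v" using p by auto
    have d: "distinct [u, x, y, v]" and e: "(u, x) \<in> parcs G" "(x, y) \<in> parcs G" "(y, v) \<in> parcs G"
      using p 4 ab G by (auto simp: vpath_def)
    have "(u, v) \<notin> parcs G"
    proof
      assume "(u, v) \<in> parcs G"
      then have "vpath [u, v] (with_proj G)" using d G uv sub by (auto simp: vpath_def)
      from le[OF this] 4 show False by simp
    qed
    moreover have "False" if w: "(u, w) \<in> parcs G" "(w, v) \<in> parcs G" for w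
    proof -
      have "vpath [u, w, v] (with_proj G)"
        using w d G uv sub no_loops' by (auto simp: vpath_def)
      from le[OF this] 4 show False by simp
    qed
    \<comment> \<open>By \<open>two\<close>, the inner vertices are not both outside
      \<open>A\<close>; if exactly one were, \<open>one\<close> would identify two vertices of the
      path.\<close>
    ultimately have "x \<in> A \<or> y \<in> A" using two[OF uv(1) _ _ uv(2) e] d by auto
    then have "x \<in> A \<and> y \<in> A" using one[of u x y] one[of x y v] e d uv by auto
    then show ?thesis using 4 ab uv by auto
  qed (use p uv G one in \<open>auto simp: vpath_def\<close>)
qed

section \<open>Graphs on an initial segment of the naturals\<close>

definition sym_graph :: "nat \<Rightarrow> (nat \<Rightarrow> nat \<Rightarrow> bool) \<Rightarrow> nat pair_pre_digraph" where
  "sym_graph N E = \<lparr>pverts = {..<N},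
     parcs = {(u, v). u < N \<and> v < N \<and> u \<noteq> v \<and> (E u v \<or> E v u)}\<rparr>"

lemma pverts_sym_graph [simp]: "pverts (sym_graph N E) = {..<N}"
  by (simp add: sym_graph_def)

lemma parcs_sym_graph [simp]:
  "(u, v) \<in> parcs (sym_graph N E) \<longleftrightarrow> u < N \<and> v < N \<and> u \<noteq> v \<and> (E u v \<or> E v u)"
  by (simp add: sym_graph_def)

lemma pair_graph_sym_graph [simp]: "pair_graph (sym_graph N E)"
proof
  show "finite (parcs (sym_graph N E))"
    by (rule finite_subset[of _ "{..<N} \<times> {..<N}"]) (auto simp: sym_graph_def)
  show "symmetric (with_proj (sym_graph N E))"
    unfolding symmetric_def by (rule symI) auto
qed (auto simp: sym_graph_def)

text \<open>Passing to smaller neighbours leads from every vertex down to \<open>0\<close>.\<close>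

lemma connected_sym_graph:
  assumes "N > 0" and parent: "\<And>v. 0 < v \<Longrightarrow> v < N \<Longrightarrow> \<exists>u<v. E u v \<or> E v u"
  shows "Digraph_Component.connected (with_proj (sym_graph N E))"
proof -
  interpret pair_graph "sym_graph N E" by simp
  let ?G = "with_proj (sym_graph N E)"
  have *: "v \<rightarrow>\<^sup>*\<^bsub>?G\<^esub> 0" if "v < N" for v
    using that
  proof (induction v rule: less_induct)
    case (less v)
    show ?case
    proof (cases "v = 0")
      case True
      then show ?thesis using less.prems by simp
    next
      case False
      then obtain u where u: "u < v" "E u v \<or> E v u" using parent less.prems by blast
      then have "(v, u) \<in> parcs (sym_graph N E)" using less.prems by auto
      then have "v \<rightarrow>\<^sup>*\<^bsub>?G\<^esub> u" by (simp add: reachable_adjI)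
      moreover have "u \<rightarrow>\<^sup>*\<^bsub>?G\<^esub> 0" using less.IH u less.prems by simp
      ultimately show ?thesis by (rule reachable_trans)
    qed
  qed
  have "0 \<rightarrow>\<^sup>*\<^bsub>?G\<^esub> v" if "v < N" for v
    using *[OF that] symmetric_reachable[OF sym_arcs] by blast
  with * have "u \<rightarrow>\<^sup>*\<^bsub>?G\<^esub> v" if "u < N" "v < N" for u v
    using that by (blast intro: reachable_trans)
  moreover have "(arcs_ends ?G)\<^sup>s = arcs_ends ?G"
    using arcs_symmetric by (auto simp: symcl_def)
  ultimately show ?thesis
    using \<open>N > 0\<close> by (auto simp: connected_conv reachable_def)
qed

lemma pverts_prism [simp]: "pverts (prism \<pi> G) = Inl ` pverts G \<union> Inr ` pverts G"
  by (simp add: prism_def)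

lemma parcs_prism [simp]:
  "(Inl u, Inl v) \<in> parcs (prism \<pi> G) \<longleftrightarrow> (u, v) \<in> parcs G"
  "(Inr u, Inr v) \<in> parcs (prism \<pi> G) \<longleftrightarrow> (u, v) \<in> parcs G"
  "(Inl u, Inr v) \<in> parcs (prism \<pi> G) \<longleftrightarrow> u \<in> pverts G \<and> v = \<pi> u"
  "(Inr v, Inl u) \<in> parcs (prism \<pi> G) \<longleftrightarrow> u \<in> pverts G \<and> v = \<pi> u"
  by (auto simp: prism_def)

subsection \<open>No upper bound\<close>

text \<open>
  The leaves at the centre \<open>0\<close> are even, those at the centre \<open>1\<close> are odd. Besides matching \<open>2 * i + 4\<close>
  with \<open>2 * i + 5\<close>, the permutation sends each centre to a leaf of its own, which keeps \<open>0\<close> and the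
  copy of \<open>1\<close> at distance \<open>3\<close>.
\<close>

definition double_star :: "nat \<Rightarrow> nat pair_pre_digraph" where
  "double_star n = sym_graph (2 * n + 4) (\<lambda>u v. u = 0 \<and> (v = 1 \<or> even v) \<or> u = 1 \<and> odd v)"

lemma pverts_double_star [simp]: "pverts (double_star n) = {..<2 * n + 4}"
  by (simp add: double_star_def)

lemma parcs_double_star [simp]:
  "(u, v) \<in> parcs (double_star n) \<longleftrightarrow> u < 2 * n + 4 \<and> v < 2 * n + 4 \<and> u \<noteq> v \<and>
     (u = 0 \<and> (v = 1 \<or> even v) \<or> u = 1 \<and> odd v \<or> v = 0 \<and> (u = 1 \<or> even u) \<or> v = 1 \<and> odd u)"
  by (auto simp: double_star_def)

definition star_perm :: "nat \<Rightarrow> nat \<Rightarrow> nat" where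
  "star_perm n k =
     (if k = 0 then 2 else if k = 2 then 0 else if k = 1 then 3 else if k = 3 then 1
      else if k < 2 * n + 4 then (if even k then k + 1 else k - 1) else k)"

lemma star_perm_star_perm: "star_perm n (star_perm n k) = k"
  by (cases "even k") (auto simp: star_perm_def elim!: evenE oddE; presburger)+

text \<open>Arcs of the prism give equations with the permutation applied to the unknown; an
  involution can be moved across.\<close>

lemma star_perm_eq_iff: "j = star_perm n k \<longleftrightarrow> k = star_perm n j"
  using star_perm_star_perm by metis

lemma star_perm_permutes: "star_perm n permutes pverts (double_star n)"
  by (rule involution_permutes) (auto simp: star_perm_star_perm, auto simp: star_perm_def)

lemma pair_graph_double_star: "pair_graph (double_star n)"
  by (simp add: double_star_def)

lemma connected_double_star: "Digraph_Component.connected (with_proj (double_star n))"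
  unfolding double_star_def
proof (rule connected_sym_graph)
  fix v :: nat
  assume "0 < v"
  then show "\<exists>u<v. (u = 0 \<and> (v = 1 \<or> even v) \<or> u = 1 \<and> odd v) \<or>
      (v = 0 \<and> (u = 1 \<or> even u) \<or> v = 1 \<and> odd u)"
    by (cases "v = 1 \<or> even v") (auto intro: exI[of _ 0] exI[of _ 1])
qed simp

text \<open>The centres are adjacent, hence form a convex set, and every leaf hangs at one of
  them.\<close>

lemma convex_domination_number_double_star: "convex_domination_number (double_star n) \<le> 2"
proof -
  let ?G = "double_star n"
  have "convex_in ?G {0, 1}"
  proof (rule convex_inI[OF pair_graph_double_star])
    fix u v :: nat
    assume uv: "u \<in> {0, 1}" "v \<in> {0, 1}"
    let ?q = "if u = v then [u] else [u, v]"
    show "\<exists>q. vpath q (with_proj ?G) \<and> hd q = u \<and> last q = v \<and> vwalk_length q \<le> 3"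
      by (rule exI[of _ ?q]) (use uv pair_graph_double_star in \<open>auto simp: vpath_def\<close>)
  qed auto
  moreover have "dominating_in ?G {0, 1}"
    by (auto simp: dominating_in_def)
  ultimately show ?thesis
    using convex_domination_number_le[of ?G "{0, 1}"] by simp
qed

text \<open>Apart from each other, the matched leaves \<open>Inl (2 * i + 4)\<close> and
  \<open>Inr (2 * i + 5)\<close> have only the neighbours \<open>Inl 0\<close> and
  \<open>Inr 1\<close> respectively. If both centres lie in \<open>A\<close>, a shortest path
  between them forces the two leaves; if one is missing, its leaf must be dominated from within the
  pair.\<close>

lemma convex_domination_number_prism_double_star:
  "n \<le> convex_domination_number (prism (star_perm n) (double_star n))"
proof -
  let ?P = "prism (star_perm n) (double_star n)"
  have P: "pair_graph ?P"
    by (intro pair_graph_prism pair_graph_double_star star_perm_permutes)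
  have perm: "star_perm n 0 = 2" "star_perm n (Suc 0) = 3" by (simp_all add: star_perm_def)
  have fin: "finite (pverts ?P)" by simp
  then obtain A where A: "convex_in ?P A" "dominating_in ?P A" "card A = convex_domination_number ?P"
    by (rule convex_domination_number_attained)
  have "finite A" using A(1) fin finite_subset by (auto simp: convex_in_def)
  moreover have "Inl (2 * i + 4) \<in> A \<or> Inr (2 * i + 5) \<in> A" if i: "i < n" for i
  proof (cases "Inl 0 \<in> A \<and> Inr 1 \<in> A")
    case True
    let ?p = "[Inl 0, Inl (2 * i + 4), Inr (2 * i + 5), Inr 1]"
    have "shortest_vpath ?P (Inl 0) ?p (Inr 1)"
      unfolding shortest_vpath_def
    proof (intro conjI allI impI)
      show "vpath ?p (with_proj ?P)"
        using i P by (auto simp: vpath_def star_perm_def)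
    next
      fix q
      assume q: "vpath q (with_proj ?P) \<and> hd q = Inl 0 \<and> last q = Inr 1"
      show "vwalk_length ?p \<le> vwalk_length q"
      proof (rule ccontr)
        assume "\<not> ?thesis"
        then have "length q \<le> 3" by (cases q) auto
        then have l: "length q \<le> 4" by simp
        have "q \<noteq> []" using q by (auto simp: vpath_def)
        from this l show False
        proof (cases rule: list_le_4_cases)
          \<comment> \<open>The middle vertex would be \<open>Inr 2\<close>, matched to
            \<open>Inl 0\<close>, or \<open>Inl 3\<close>, matched to \<open>Inr 1\<close>; each is
            a leaf at the wrong centre.\<close>
          case (3 a b c)
          then show ?thesis using q P
            by (cases b) (auto simp: vpath_def perm star_perm_eq_iff[of "Suc 0"])
        qed (use q P \<open>length q \<le> 3\<close> in \<open>auto simp: vpath_def star_perm_def\<close>)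
      qed
    qed auto
    then show ?thesis using A(1) True unfolding convex_in_def by fastforce
  next
    case False
    have *: "x \<in> A \<or> (\<exists>u\<in>A. (u, x) \<in> parcs ?P)" if "x \<in> pverts ?P" for x
      using A(2) that by (auto simp: dominating_in_def)
    have nl: "u = Inl 0 \<or> u = Inr (2 * i + 5)" if "(u, Inl (2 * i + 4)) \<in> parcs ?P" for u
      using that by (cases u) (auto simp: star_perm_def)
    have "star_perm n (2 * i + 5) = 2 * i + 4"
      using i by (simp add: star_perm_def)
    then have nr: "u = Inr 1 \<or> u = Inl (2 * i + 4)" if "(u, Inr (2 * i + 5)) \<in> parcs ?P" for u
      using that star_perm_eq_iff[of "2 * i + 5"] by (cases u) auto
    show ?thesis
      using False *[of "Inl (2 * i + 4)"] *[of "Inr (2 * i + 5)"] nl nr i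
      by auto
  qed
  ultimately have "n \<le> card A"
    by (rule card_ge_of_disjoint_pairs) (auto simp: inj_def)
  then show ?thesis using A(3) by simp
qed

subsection \<open>No lower bound\<close>

text \<open>
  The leaves at \<open>0\<close> are \<open>1\<close>, \<open>2\<close> and the even numbers from \<open>6\<close> on; the odd numbers from \<open>3\<close> on, except
  \<open>5\<close>, are the midpoints of the paths from \<open>0\<close> to \<open>4\<close>; and \<open>5\<close> is a leaf at \<open>4\<close>. Dominating \<open>5\<close> requires
  \<open>4\<close> or \<open>5\<close>, and together with \<open>0\<close> either of them forces all midpoints.
\<close>

definition theta_graph :: "nat \<Rightarrow> nat pair_pre_digraph" where
  "theta_graph n = sym_graph (2 * n + 6) (\<lambda>u v. u = 0 \<and> v \<noteq> 4 \<and> v \<noteq> 5 \<or> u = 4 \<and> odd v \<and> v \<noteq> 1)"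

lemma pverts_theta_graph [simp]: "pverts (theta_graph n) = {..<2 * n + 6}"
  by (simp add: theta_graph_def)

lemma parcs_theta_graph [simp]:
  "(u, v) \<in> parcs (theta_graph n) \<longleftrightarrow> u < 2 * n + 6 \<and> v < 2 * n + 6 \<and> u \<noteq> v \<and>
     (u = 0 \<and> v \<noteq> 4 \<and> v \<noteq> 5 \<or> u = 4 \<and> odd v \<and> v \<noteq> 1 \<or>
      v = 0 \<and> u \<noteq> 4 \<and> u \<noteq> 5 \<or> v = 4 \<and> odd u \<and> u \<noteq> 1)"
  by (auto simp: theta_graph_def)

text \<open>Exchanging two leaves of \<open>0\<close> with \<open>4\<close> and \<open>5\<close>
  lets these leaves, in each layer, dominate the far end of the other layer.\<close>

definition theta_perm :: "nat \<Rightarrow> nat" where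
  "theta_perm k =
     (if k = 1 then 4 else if k = 4 then 1 else if k = 2 then 5 else if k = 5 then 2 else k)"

lemma theta_perm_eq_iffs:
  "0 = theta_perm k \<longleftrightarrow> k = 0" "Suc 0 = theta_perm k \<longleftrightarrow> k = 4" "2 = theta_perm k \<longleftrightarrow> k = 5"
  by (auto simp: theta_perm_def)

lemma theta_perm_permutes: "theta_perm permutes pverts (theta_graph n)"
  by (rule involution_permutes) (auto simp: theta_perm_def theta_graph_def)

lemma pair_graph_theta_graph: "pair_graph (theta_graph n)"
  by (simp add: theta_graph_def)

lemma connected_theta_graph: "Digraph_Component.connected (with_proj (theta_graph n))"
  unfolding theta_graph_def
proof (rule connected_sym_graph)
  fix v :: nat
  assume "0 < v"
  then show "\<exists>u<v. (u = 0 \<and> v \<noteq> 4 \<and> v \<noteq> 5 \<or> u = 4 \<and> odd v \<and> v \<noteq> 1) \<or>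
      (v = 0 \<and> u \<noteq> 4 \<and> u \<noteq> 5 \<or> v = 4 \<and> odd u \<and> u \<noteq> 1)"
    by (cases "v = 4"; cases "v = 5") (auto intro: exI[of _ 0] exI[of _ 3] exI[of _ 4])
qed simp

text \<open>With \<open>0\<close> in \<open>A\<close> all midpoints \<open>2 * i + 7\<close> are
  forced; without it each leaf \<open>2 * i + 6\<close> must itself belong to
  \<open>A\<close>.\<close>

lemma convex_domination_number_theta_graph: "n \<le> convex_domination_number (theta_graph n)"
proof -
  let ?G = "theta_graph n"
  have G: "pair_graph ?G" by (rule pair_graph_theta_graph)
  have fin: "finite (pverts ?G)" by simp
  then obtain A where A: "convex_in ?G A" "dominating_in ?G A" "card A = convex_domination_number ?G"
    by (rule convex_domination_number_attained)
  have "finite A" using A(1) fin finite_subset by (auto simp: convex_in_def)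
  have dom: "x \<in> A \<or> (\<exists>u\<in>A. (u, x) \<in> parcs ?G)" if "x < 2 * n + 6" for x
    using A(2) that by (auto simp: dominating_in_def)
  have 45: "4 \<in> A \<or> 5 \<in> A"
    using dom[of 5] by auto
  have "2 * i + 7 \<in> A \<or> 2 * i + 6 \<in> A" if i: "i < n" for i
  proof (cases "0 \<in> A")
    case True
    have p4: "shortest_vpath ?G 0 [0, 2 * i + 7, 4] 4"
      unfolding shortest_vpath_def
    proof (intro conjI allI impI)
      show "vpath [0, 2 * i + 7, 4] (with_proj ?G)"
        using i G by (auto simp: vpath_def)
    next
      fix q
      assume q: "vpath q (with_proj ?G) \<and> hd q = 0 \<and> last q = 4"
      show "vwalk_length [0, 2 * i + 7, 4] \<le> vwalk_length q"
      proof (rule ccontr)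
        assume "\<not> ?thesis"
        then have "length q \<le> 2" by (cases q) auto
        then have l: "length q \<le> 4" by simp
        have "q \<noteq> []" using q by (auto simp: vpath_def)
        from this l show False
          by (cases rule: list_le_4_cases)
            (use q G \<open>length q \<le> 2\<close> in \<open>auto simp: vpath_def\<close>)
      qed
    qed auto
    \<comment> \<open>This covers the case that \<open>A\<close> contains \<open>5\<close> but not
      \<open>4\<close>.\<close>
    have p5: "shortest_vpath ?G 0 [0, 2 * i + 7, 4, 5] 5"
      unfolding shortest_vpath_def
    proof (intro conjI allI impI)
      show "vpath [0, 2 * i + 7, 4, 5] (with_proj ?G)"
        using i G by (auto simp: vpath_def)
    next
      fix q
      assume q: "vpath q (with_proj ?G) \<and> hd q = 0 \<and> last q = 5"
      show "vwalk_length [0, 2 * i + 7, 4, 5] \<le> vwalk_length q"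
      proof (rule ccontr)
        assume "\<not> ?thesis"
        then have "length q \<le> 3" by (cases q) auto
        then have l: "length q \<le> 4" by simp
        have "q \<noteq> []" using q by (auto simp: vpath_def)
        from this l show False
          by (cases rule: list_le_4_cases)
            (use q G \<open>length q \<le> 3\<close> in \<open>auto simp: vpath_def\<close>)
      qed
    qed auto
    show ?thesis using 45 A(1) True p4 p5 unfolding convex_in_def by fastforce
  next
    case False
    then show ?thesis using dom[of "2 * i + 6"] i by auto
  qed
  with \<open>finite A\<close> have "n \<le> card A"
    by (rule card_ge_of_disjoint_pairs) (auto simp: inj_def, presburger)
  then show ?thesis using A(3) by simp
qed

text \<open>The two zeros dominate everything except the vertices over \<open>4\<close> and
  \<open>5\<close>, which are matched to the leaves in \<open>?A\<close>. An outside vertex has at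
  most one neighbour in \<open>?A\<close>, so only a detour through two outside vertices could break
  convexity.\<close>

lemma convex_domination_number_prism_theta_graph:
  "convex_domination_number (prism theta_perm (theta_graph n)) \<le> 6"
proof -
  let ?P = "prism theta_perm (theta_graph n)"
  let ?A = "{Inl 0, Inl 1, Inl 2, Inr 0, Inr 1, Inr 2} :: (nat + nat) set"
  have P: "pair_graph ?P"
    by (intro pair_graph_prism pair_graph_theta_graph theta_perm_permutes)
  interpret P: pair_graph ?P by (rule P)
  \<comment> \<open>The only possible neighbour in \<^term>\<open>?A\<close> of a vertex outside \<^term>\<open>?A\<close>.\<close>
  define attach :: "nat + nat \<Rightarrow> nat + nat" where "attach = (\<lambda>x. case x of
      Inl k \<Rightarrow> if k = 4 then Inr 1 else if k = 5 then Inr 2 else Inl 0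
    | Inr k \<Rightarrow> if k = 4 then Inl 1 else if k = 5 then Inl 2 else Inr 0)"
  have attach: "u = attach x" if "u \<in> ?A" "x \<notin> ?A" "(u, x) \<in> parcs ?P" for u x
    using that
    by (elim insertE emptyE; cases x)
      (simp_all add: attach_def theta_perm_eq_iffs, auto simp: theta_perm_def)
  have "convex_in ?P ?A"
  proof (rule convex_inI[OF P])
    show "?A \<subseteq> pverts ?P" by auto
  next
    fix u v :: "nat + nat"
    assume uv: "u \<in> ?A" "v \<in> ?A"
    \<comment> \<open>The walk goes through the zero of each layer; \<open>remdups_adj\<close>
      removes the repetitions, and \<open>u = v\<close> is separate since the walk would return to
      its start.\<close>
    define h where "h = (\<lambda>x :: nat + nat. case x of Inl _ \<Rightarrow> Inl 0 :: nat + nat | Inr _ \<Rightarrow> Inr 0)"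
    let ?q = "remdups_adj [u, h u, h v, v]"
    let ?r = "if u = v then [u] else ?q"
    show "\<exists>q. vpath q (with_proj ?P) \<and> hd q = u \<and> last q = v \<and> vwalk_length q \<le> 3"
      by (rule exI[of _ ?r], insert uv, elim insertE emptyE)
        (simp_all add: P vpath_def theta_perm_def h_def)
  next
    fix u x v
    assume "u \<in> ?A" "x \<notin> ?A" "v \<in> ?A" "(u, x) \<in> parcs ?P" "(x, v) \<in> parcs ?P"
    then show "u = v"
      using attach P.arcs_symmetric by metis
  next
    fix u x y v
    assume *: "u \<in> ?A" "x \<notin> ?A" "y \<notin> ?A" "v \<in> ?A"
      "(u, x) \<in> parcs ?P" "(x, y) \<in> parcs ?P" "(y, v) \<in> parcs ?P"
    then have "u = attach x" "v = attach y"
      using attach P.arcs_symmetric by blast+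
    \<comment> \<open>Such a detour has length 3, while its ends are at distance at most 2 by way of
      one of the zeros.\<close>
    moreover have "attach x = attach y \<or> (attach x, attach y) \<in> parcs ?P
        \<or> (attach x, Inl 0) \<in> parcs ?P \<and> (Inl 0, attach y) \<in> parcs ?P
        \<or> (attach x, Inr 0) \<in> parcs ?P \<and> (Inr 0, attach y) \<in> parcs ?P"
      using *(2,3,6) by (cases x; cases y) (auto simp: attach_def theta_perm_def)
    ultimately show "u = v \<or> (u, v) \<in> parcs ?P \<or> (\<exists>w. (u, w) \<in> parcs ?P \<and> (w, v) \<in> parcs ?P)"
      by blast
  qed
  moreover have "dominating_in ?P ?A"
    unfolding dominating_in_def
  proof (intro conjI ballI)
    show "?A \<subseteq> pverts ?P" by auto
  next
    fix v
    assume "v \<in> pverts ?P"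
    then show "v \<in> ?A \<or> (\<exists>u\<in>?A. (u, v) \<in> parcs ?P)"
      by (cases v) (auto simp: theta_perm_def)
  qed
  ultimately have "convex_domination_number ?P \<le> card ?A"
    by (intro convex_domination_number_le) auto
  then show ?thesis by simp
qed

theorem mainTheorem3:
  shows "(\<nexists>f :: nat \<Rightarrow> nat. \<forall>(G :: nat pair_pre_digraph) \<pi>.
            pair_graph G \<and> Digraph_Component.connected (with_proj G) \<and> \<pi> permutes pverts G \<longrightarrow>
            convex_domination_number (prism \<pi> G) \<le> f (convex_domination_number G)) \<and>
         (\<nexists>f :: nat \<Rightarrow> nat. \<forall>(G :: nat pair_pre_digraph) \<pi>.
            pair_graph G \<and> Digraph_Component.connected (with_proj G) \<and> \<pi> permutes pverts G \<longrightarrow>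
            convex_domination_number G \<le> f (convex_domination_number (prism \<pi> G)))"
proof (intro conjI notI; elim exE)
  fix f :: "nat \<Rightarrow> nat"
  assume f: "\<forall>(G :: nat pair_pre_digraph) \<pi>.
    pair_graph G \<and> Digraph_Component.connected (with_proj G) \<and> \<pi> permutes pverts G \<longrightarrow>
    convex_domination_number (prism \<pi> G) \<le> f (convex_domination_number G)"
  \<comment> \<open>Since \<open>f\<close> need not be monotone, \<open>n\<close> is taken above all
    its values on the possible arguments.\<close>
  define n where "n = Suc (Max (f ` {..2}))"
  have "n \<le> f (convex_domination_number (double_star n))"
    using f pair_graph_double_star connected_double_star star_perm_permutes
      convex_domination_number_prism_double_star order_trans by metis
  also have "\<dots> \<le> Max (f ` {..2})"
    using convex_domination_number_double_star by (intro Max_ge) auto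
  finally show False by (simp add: n_def)
next
  fix f :: "nat \<Rightarrow> nat"
  assume f: "\<forall>(G :: nat pair_pre_digraph) \<pi>.
    pair_graph G \<and> Digraph_Component.connected (with_proj G) \<and> \<pi> permutes pverts G \<longrightarrow>
    convex_domination_number G \<le> f (convex_domination_number (prism \<pi> G))"
  define n where "n = Suc (Max (f ` {..6}))"
  have "n \<le> f (convex_domination_number (prism theta_perm (theta_graph n)))"
    using f pair_graph_theta_graph connected_theta_graph theta_perm_permutes
      convex_domination_number_theta_graph order_trans by metis
  also have "\<dots> \<le> Max (f ` {..6})"
    using convex_domination_number_prism_theta_graph by (intro Max_ge) auto
  finally show False by (simp add: n_def)
qed

end
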